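(* Let $m,k\in\mathbb{N}$ with $k\ge2$, and let $T\subseteq\Sigma_m^*$ be a finite tree with $k$ terminal nodes $\tau_0,\dots,\tau_{k-1}$, inducing the length function $\ell_T$. Let $\rho$ be the Perron eigenvalue of the adjacency matrix of the directed graph associated to $T$. Then $\log(\rho)$ is the channel capacity of $\ell_T$.
   Context: Logarithms are to base 2. $\Sigma_m=\{0,1,\dots,m-1\}$ and $\Sigma_m^*$ is the set of finite strings over $\Sigma_m$; $|\sigma|$ is the number of symbols of $\sigma$. A tree is a subset of $\Sigma_m^*$ closed under taking initial segments. A finite tree $T$ is specified by a finite prefix-free set $S\subseteq\Sigma_m^*$ (no element is a proper initial segment of another), $T$ being the set of all initial segments of elements of $S$; the elements of $S$ are the terminal nodes of $T$ and the other elements of $T$ are its non-terminal nodes. A node $\sigma$ is the parent of $\tau$ if $\tau$ is $\sigma$ followed by exactly one symbol. A length function on $\Sigma_k$ is a function $\ell:\Sigma_k\to\mathbb{N}$; its channel capacity is the unique real $\alpha\ge0$ with $\sum_{i=0}^{k-1}2^{-\alpha\ell(i)}=1$. The length function induced by $T$ is $\ell_T:\Sigma_k\to\mathbb{N}$, $\ell_T(i)=|\tau_i|$. The directed graph $G$ associated to $T$: let $\sigma_1,\dots,\sigma_n$ be the non-terminal nodes of $T$ in length-lexicographic order, so that $\sigma_1$ is the root (the empty string). $G$ has vertices $v_1,\dots,v_n$. For each pair $i,j$ such that $\sigma_i$ is the parent of $\sigma_j$, there is one directed edge from $v_i$ to $v_j$. In addition, for each $i$ and each terminal node whose parent is $\sigma_i$,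 there is one directed edge from $v_i$ to $v_1$ (so there may be multiple edges and loops at $v_1$). These are all the edges. The adjacency matrix $A$ of $G$ has $(i,j)$ entry equal to the number of directed edges from $v_i$ to $v_j$; it is a non-negative irreducible matrix, and its Perron eigenvalue $\rho$ is its largest positive real eigenvalue, i.e. its spectral radius. *)

theory Defs
  imports
    Complex_Main
    "HOL-Library.Sublist"
    "HOL-Library.List_Lenlexorder"
    "Graph_Theory.Digraph"
    "Jordan_Normal_Form.Char_Poly"
begin

text \<open>Strings over the alphabet \<open>{0, \<dots>, m - 1}\<close> are the elements of \<open>lists {..<m}\<close>.
  A finite tree \<open>T\<close> is given by the prefix-free set \<open>S\<close> of its terminal nodes, so that
  \<open>T - S\<close> is the set of its non-terminal nodes.\<close>

definition finite_tree :: "nat \<Rightarrow> nat list set \<Rightarrow> nat list set \<Rightarrow> bool" where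
  "finite_tree m T S \<longleftrightarrow>
     finite S \<and> S \<subseteq> lists {..<m} \<and> (\<forall>\<sigma>\<in>S. \<forall>\<tau>\<in>S. \<not> strict_prefix \<sigma> \<tau>) \<and>
     T = {\<sigma>. \<exists>\<tau>\<in>S. prefix \<sigma> \<tau>}"

definition is_parent :: "nat list \<Rightarrow> nat list \<Rightarrow> bool" where
  "is_parent \<sigma> \<tau> \<longleftrightarrow> (\<exists>a. \<tau> = \<sigma> @ [a])"

text \<open>The channel capacity of the length function \<open>l\<close> on \<open>{0, \<dots>, k - 1}\<close>, as a relation that
  includes the uniqueness of the solution.\<close>

definition is_channel_capacity :: "nat \<Rightarrow> (nat \<Rightarrow> nat) \<Rightarrow> real \<Rightarrow> bool" where
  "is_channel_capacity k l \<alpha> \<longleftrightarrow>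
     0 \<le> \<alpha> \<and> (\<Sum>i<k. 2 powr (- \<alpha> * real (l i))) = 1 \<and>
     (\<forall>\<beta>\<ge>0. (\<Sum>i<k. 2 powr (- \<beta> * real (l i))) = 1 \<longrightarrow> \<beta> = \<alpha>)"

text \<open>Arcs carry labels, since there can be several of them between the same two vertices:
  \<open>Down i j\<close> is the arc from vertex \<open>i\<close> to a non-terminal child \<open>j\<close>, and \<open>Return i \<tau>\<close> is the
  arc from vertex \<open>i\<close> back to the root that belongs to a terminal child \<open>\<tau>\<close>.\<close>

datatype tree_arc = Down nat nat | Return nat "nat list"

primrec arc_tail :: "tree_arc \<Rightarrow> nat" where
  "arc_tail (Down i j) = i"
| "arc_tail (Return i \<tau>) = i"

primrec arc_head :: "tree_arc \<Rightarrow> nat" where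
  "arc_head (Down i j) = j"
| "arc_head (Return i \<tau>) = 0"

text \<open>The order on \<^typ>\<open>nat list\<close> is the length-lexicographic one, from
  \<^theory>\<open>HOL-Library.List_Lenlexorder\<close>. Vertices are numbered from \<open>0\<close>, so the root
  (the empty list) is vertex \<open>0\<close>.\<close>

definition nonterminal_nodes :: "nat list set \<Rightarrow> nat list set \<Rightarrow> nat list list" where
  "nonterminal_nodes T S = sorted_list_of_set (T - S)"

definition tree_graph :: "nat list set \<Rightarrow> nat list set \<Rightarrow> (nat, tree_arc) pre_digraph" where
  "tree_graph T S =
     (let \<sigma>s = nonterminal_nodes T S; n = length \<sigma>s in
      \<lparr> verts = {..<n},
        arcs = {Down i j | i j. i < n \<and> j < n \<and> is_parent (\<sigma>s ! i) (\<sigma>s ! j)} \<union>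
               {Return i \<tau> | i \<tau>. i < n \<and> \<tau> \<in> S \<and> is_parent (\<sigma>s ! i) \<tau>},
        tail = arc_tail,
        head = arc_head \<rparr>)"

text \<open>For a digraph whose vertices are the numbers below some \<open>n\<close>.\<close>

definition adjacency_matrix :: "(nat, 'e) pre_digraph \<Rightarrow> real mat" where
  "adjacency_matrix G =
     mat (card (verts G)) (card (verts G))
       (\<lambda>(i, j). real (card {e \<in> arcs G. tail G e = i \<and> head G e = j}))"

definition perron_eigenvalue :: "real mat \<Rightarrow> real" where
  "perron_eigenvalue A = Max {\<rho>. 0 < \<rho> \<and> eigenvalue A \<rho>}"

end

theory Submission
  imports Defs
begin

text \<open>Call a function on the nodes of the tree \<^emph>\<open>harmonic\<close> at a node, for the factor \<open>\<rho>\<close>, if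
  \<open>\<rho>\<close> times its value there is the sum of its values at the children. Every terminal node is
  identified with the root by the graph, so a vector on the vertices is the same thing as a
  function on all nodes that takes its root value at each terminal node. Under this
  correspondence multiplication by the adjacency matrix sums over children
  (\<open>adjacency_mult_vec\<close>), and an eigenvector for \<open>\<rho>\<close> is a nonzero function harmonic
  at all non-terminal nodes.

  A harmonic function is determined by its values at the terminal nodes: unfolding the recursion
  from the root downwards, the value at \<open>\<sigma>\<close> is the sum over the terminal nodes \<open>\<tau>\<close>
  above \<open>\<sigma>\<close> of the value at \<open>\<tau>\<close> times \<open>\<rho>\<close> to the power
  \<open>length \<sigma> - length \<tau>\<close>. With the same value \<open>c\<close> at all terminal nodes and at
  the root this forces \<open>c \<noteq> 0\<close> and, at the root, \<open>\<Sum>\<tau>. \<rho> ^ - length \<tau> = 1\<close>;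
  conversely this equation makes the explicit solution an eigenvector
  (\<open>eigenvalue_iff_leaf_weight\<close>). In terms of \<open>log 2 \<rho>\<close> this is exactly the equation
  defining the channel capacity. Its left side is strictly decreasing and continuous, so it has
  one solution (\<open>ex1_capacity\<close>). Hence the matrix has a single positive eigenvalue,
  the Perron eigenvalue, and its logarithm is the capacity.\<close>

section \<open>The capacity equation\<close>

lemma powr_sum_strict_antimono:
  fixes l :: "'a \<Rightarrow> nat" and \<alpha> \<beta> :: real
  assumes "finite I" "I \<noteq> {}" "\<And>i. i \<in> I \<Longrightarrow> 0 < l i" "\<alpha> < \<beta>"
  shows "(\<Sum>i\<in>I. 2 powr (- \<beta> * real (l i))) < (\<Sum>i\<in>I. 2 powr (- \<alpha> * real (l i)))"
  using assms by (intro sum_strict_mono) auto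

lemma ex1_capacity:
  fixes l :: "'a \<Rightarrow> nat"
  assumes fin: "finite I" and card: "2 \<le> card I" and pos: "\<And>i. i \<in> I \<Longrightarrow> 0 < l i"
  shows "\<exists>\<alpha>>0. \<forall>\<beta>. (\<Sum>i\<in>I. 2 powr (- \<beta> * real (l i))) = 1 \<longleftrightarrow> \<beta> = \<alpha>"
proof -
  define F where "F \<beta> = (\<Sum>i\<in>I. 2 powr (- \<beta> * real (l i)))" for \<beta>
  define b where "b = log 2 (real (card I))"
  have ne: "I \<noteq> {}"
    using card by auto
  have anti: "F \<beta> < F \<alpha>" if "\<alpha> < \<beta>" for \<alpha> \<beta>
    unfolding F_def using powr_sum_strict_antimono[of I l \<alpha> \<beta>] fin ne pos that by simp
  have F0: "F 0 = real (card I)"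
    by (simp add: F_def)
  have b: "0 \<le> b"
    using card by (simp add: b_def)
  \<comment> \<open>All lengths are at least 1, so at the logarithm of the number of terms no term exceeds the
      reciprocal of that number.\<close>
  have "F b \<le> (\<Sum>i\<in>I. 1 / real (card I))"
    unfolding F_def
  proof (rule sum_mono)
    fix i assume "i \<in> I"
    then have "1 \<le> real (l i)"
      using pos[of i] by simp
    then have "- b * real (l i) \<le> - b"
      using b by (simp add: mult_le_cancel_left1)
    then have "2 powr (- b * real (l i)) \<le> 2 powr (- b)"
      by simp
    also have "\<dots> = 1 / real (card I)"
      using card by (simp add: b_def powr_minus divide_inverse)
    finally show "2 powr (- b * real (l i)) \<le> 1 / real (card I)" .
  qed
  also have "\<dots> = 1"
    using card by simp
  finally have Fb: "F b \<le> 1" .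
  have "continuous_on {0..b} F"
    unfolding F_def by (intro continuous_intros) auto
  then obtain \<alpha> where \<alpha>: "0 \<le> \<alpha>" "F \<alpha> = 1"
    using IVT2'[of F b 1 0] Fb F0 card b by auto
  have "\<alpha> \<noteq> 0"
    using \<alpha> F0 card by auto
  moreover have "F \<beta> = 1 \<longleftrightarrow> \<beta> = \<alpha>" for \<beta>
    using anti[of \<alpha> \<beta>] anti[of \<beta> \<alpha>] \<alpha>(2) by (cases \<alpha> \<beta> rule: linorder_cases) auto
  ultimately show ?thesis
    using \<alpha>(1) unfolding F_def by (intro exI[of _ \<alpha>]) auto
qed

section \<open>Harmonic functions on a tree\<close>

text \<open>The value at \<open>\<sigma>\<close> of the function with value 1 at the terminal nodes that is harmonic for
  the factor \<open>1 / x\<close>; at the root it is the left side of the capacity equation.\<close>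

definition leaf_weight :: "nat list set \<Rightarrow> real \<Rightarrow> nat list \<Rightarrow> real" where
  "leaf_weight S x \<sigma> = (\<Sum>\<tau> | \<tau> \<in> S \<and> prefix \<sigma> \<tau>. x ^ (length \<tau> - length \<sigma>))"

definition children :: "nat list set \<Rightarrow> nat list \<Rightarrow> nat list set" where
  "children T \<sigma> = {c \<in> T. is_parent \<sigma> c}"

locale nontrivial_tree =
  fixes m :: nat and T S :: "nat list set"
  assumes tree: "finite_tree m T S" and S_ne: "S \<noteq> {}" and Nil_notin_S: "[] \<notin> S"
begin

lemma finite_S: "finite S"
  using tree by (simp add: finite_tree_def)

lemma T_eq: "T = {\<sigma>. \<exists>\<tau>\<in>S. prefix \<sigma> \<tau>}"
  using tree by (simp add: finite_tree_def)

lemma S_subset_T: "S \<subseteq> T"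
  by (auto simp: T_eq)

lemma finite_T: "finite T"
proof -
  have "T = (\<Union>\<tau>\<in>S. set (prefixes \<tau>))"
    by (auto simp: T_eq)
  then show ?thesis
    using finite_S by simp
qed

lemma Nil_nonterminal: "[] \<in> T - S"
  using S_ne Nil_notin_S by (auto simp: T_eq)

lemma prefix_terminal_eq:
  assumes "\<sigma> \<in> S" "\<tau> \<in> S" "prefix \<sigma> \<tau>"
  shows "\<tau> = \<sigma>"
  using tree assms by (auto simp: finite_tree_def strict_prefix_def)

lemma leaf_weight_terminal:
  assumes "\<sigma> \<in> S"
  shows "leaf_weight S x \<sigma> = 1"
proof -
  have "{\<tau>. \<tau> \<in> S \<and> prefix \<sigma> \<tau>} = {\<sigma>}"
    using assms prefix_terminal_eq by auto
  then show ?thesis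
    by (simp add: leaf_weight_def)
qed

text \<open>Each terminal node above a non-terminal node lies above exactly one of its children.\<close>

lemma leaf_weight_nonterminal:
  assumes "\<sigma> \<notin> S"
  shows "leaf_weight S x \<sigma> = x * (\<Sum>c\<in>children T \<sigma>. leaf_weight S x c)"
proof -
  let ?L = "\<lambda>c. {\<tau>. \<tau> \<in> S \<and> prefix c \<tau>}"
  have union: "?L \<sigma> = (\<Union>c\<in>children T \<sigma>. ?L c)"
  proof (intro equalityI subsetI)
    fix \<tau> assume \<tau>: "\<tau> \<in> ?L \<sigma>"
    then obtain zs where zs: "\<tau> = \<sigma> @ zs"
      by (auto simp: prefix_def)
    with \<tau> assms obtain a as where "zs = a # as"
      by (cases zs) auto
    then have "prefix (\<sigma> @ [a]) \<tau>"
      using zs by simp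
    then show "\<tau> \<in> (\<Union>c\<in>children T \<sigma>. ?L c)"
      using \<tau> by (auto simp: children_def is_parent_def T_eq)
  next
    fix \<tau> assume "\<tau> \<in> (\<Union>c\<in>children T \<sigma>. ?L c)"
    then show "\<tau> \<in> ?L \<sigma>"
      by (auto simp: children_def is_parent_def dest: append_prefixD)
  qed
  have "leaf_weight S x \<sigma> =
      (\<Sum>c\<in>children T \<sigma>. \<Sum>\<tau>\<in>?L c. x ^ (length \<tau> - length \<sigma>))"
    unfolding leaf_weight_def union
  proof (rule sum.UNION_disjoint)
    show "finite (children T \<sigma>)"
      using finite_T by (simp add: children_def)
    show "\<forall>c\<in>children T \<sigma>. finite (?L c)"
      using finite_S by simp
    show "\<forall>c\<in>children T \<sigma>. \<forall>d\<in>children T \<sigma>. c \<noteq> d \<longrightarrow> ?L c \<inter> ?L d = {}"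
      by (auto simp: children_def is_parent_def prefix_def)
  qed
  also have "\<dots> = (\<Sum>c\<in>children T \<sigma>. x * leaf_weight S x c)"
  proof (rule sum.cong[OF refl])
    fix c assume "c \<in> children T \<sigma>"
    then have len: "length c = Suc (length \<sigma>)"
      by (auto simp: children_def is_parent_def)
    have "x ^ (length \<tau> - length \<sigma>) = x * x ^ (length \<tau> - length c)" if "prefix c \<tau>" for \<tau>
    proof -
      have "length \<tau> - length \<sigma> = Suc (length \<tau> - length c)"
        using prefix_length_le[OF that] len by simp
      then show ?thesis
        by simp
    qed
    then show "(\<Sum>\<tau>\<in>?L c. x ^ (length \<tau> - length \<sigma>)) = x * leaf_weight S x c"
      by (simp add: leaf_weight_def sum_distrib_left)
  qed
  finally show ?thesis
    by (simp add: sum_distrib_left)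
qed

text \<open>Both sides satisfy the same recursion from the terminal nodes downwards, so the induction
  runs over the distance to the greatest length in the tree.\<close>

lemma harmonic_eq_leaf_weight:
  assumes harm: "\<And>\<sigma>. \<sigma> \<in> T - S \<Longrightarrow> u \<sigma> = x * (\<Sum>c\<in>children T \<sigma>. u c)"
    and leaf: "\<And>\<tau>. \<tau> \<in> S \<Longrightarrow> u \<tau> = a"
    and "\<sigma> \<in> T"
  shows "u \<sigma> = a * leaf_weight S x \<sigma>"
  using \<open>\<sigma> \<in> T\<close>
proof (induction "Max (length ` T) - length \<sigma>" arbitrary: \<sigma> rule: less_induct)
  case less
  show ?case
  proof (cases "\<sigma> \<in> S")
    case True
    then show ?thesis
      by (simp add: leaf leaf_weight_terminal)
  next
    case False
    have "u c = a * leaf_weight S x c" if "c \<in> children T \<sigma>" for c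
    proof (rule less.hyps)
      have c: "c \<in> T" "length c = Suc (length \<sigma>)"
        using that by (auto simp: children_def is_parent_def)
      have "length c \<le> Max (length ` T)"
        using finite_T c(1) by (intro Max_ge finite_imageI imageI)
      then show "Max (length ` T) - length c < Max (length ` T) - length \<sigma>"
        using c by simp
      show "c \<in> T"
        by fact
    qed
    then show ?thesis
      using False less.prems harm[of \<sigma>] leaf_weight_nonterminal[OF False, of x]
      by (simp add: sum_distrib_left mult_ac)
  qed
qed

section \<open>The adjacency matrix acts by summing over children\<close>

abbreviation "nodes \<equiv> nonterminal_nodes T S"

abbreviation "A \<equiv> adjacency_matrix (tree_graph T S)"

lemma set_nodes: "set nodes = T - S"
  using finite_T by (simp add: nonterminal_nodes_def)

lemma bij_nodes: "bij_betw ((!) nodes) {..<length nodes} (T - S)"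
proof (rule bij_betw_nth[OF _ refl set_nodes[symmetric]])
  show "distinct nodes"
    by (simp add: nonterminal_nodes_def)
qed

lemma length_nodes_pos: "0 < length nodes"
  using Nil_nonterminal set_nodes by (metis length_pos_if_in_set)

lemma nodes_0: "nodes ! 0 = []"
proof -
  have "Min (T - S) = []"
    using finite_T Nil_nonterminal by (intro Min_eqI) auto
  then show ?thesis
    using finite_T Nil_nonterminal
    unfolding nonterminal_nodes_def by (subst sorted_list_of_set_nonempty) auto
qed

lemma A_carrier: "A \<in> carrier_mat (length nodes) (length nodes)"
  by (simp add: adjacency_matrix_def tree_graph_def Let_def)

lemma A_entry:
  assumes "i < length nodes" "j < length nodes"
  shows "A $$ (i, j) = (if is_parent (nodes ! i) (nodes ! j) then 1 else 0) +
    (if j = 0 then real (card {\<tau> \<in> S. is_parent (nodes ! i) \<tau>}) else 0)"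
proof -
  let ?D = "if is_parent (nodes ! i) (nodes ! j) then {Down i j} else {}"
  let ?R = "if j = 0 then Return i ` {\<tau> \<in> S. is_parent (nodes ! i) \<tau>} else {}"
  let ?G = "tree_graph T S"
  have "{e \<in> arcs ?G. tail ?G e = i \<and> head ?G e = j} = ?D \<union> ?R"
    using assms by (auto simp: tree_graph_def Let_def)
  moreover have "card (?D \<union> ?R) = card ?D + card ?R"
    using finite_S by (intro card_Un_disjoint) auto
  moreover have "card (Return i ` {\<tau> \<in> S. is_parent (nodes ! i) \<tau>}) =
      card {\<tau> \<in> S. is_parent (nodes ! i) \<tau>}"
    by (intro card_image) (auto simp: inj_on_def)
  moreover have "A $$ (i, j) = real (card {e \<in> arcs ?G. tail ?G e = i \<and> head ?G e = j})"
    using assms by (simp add: adjacency_matrix_def) (simp add: tree_graph_def Let_def)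
  ultimately show ?thesis
    by simp
qed

text \<open>The column of the root collects all terminal children, and each of them contributes
  the root value of \<open>u\<close>, which is also its own value.\<close>

lemma adjacency_mult_vec:
  assumes i: "i < length nodes" and u: "\<And>\<tau>. \<tau> \<in> S \<Longrightarrow> u \<tau> = u []"
  shows "(A *\<^sub>v vec (length nodes) (\<lambda>j. u (nodes ! j))) $ i =
    (\<Sum>c\<in>children T (nodes ! i). u c)"
proof -
  let ?n = "length nodes"
  let ?P = "is_parent (nodes ! i)"
  let ?r = "real (card {\<tau> \<in> S. ?P \<tau>})"
  have "(A *\<^sub>v vec ?n (\<lambda>j. u (nodes ! j))) $ i = (\<Sum>j<?n. A $$ (i, j) * u (nodes ! j))"
    using A_carrier i by (simp add: scalar_prod_def atLeast0LessThan)
  also have "\<dots> = (\<Sum>j<?n. (if ?P (nodes ! j) then u (nodes ! j) else 0) +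
      (if j = 0 then ?r * u [] else 0))"
    using i by (intro sum.cong) (auto simp: A_entry nodes_0 distrib_right)
  also have "\<dots> = (\<Sum>j<?n. if ?P (nodes ! j) then u (nodes ! j) else 0) + ?r * u []"
    using length_nodes_pos by (simp add: sum.distrib sum.delta)
  also have "(\<Sum>j<?n. if ?P (nodes ! j) then u (nodes ! j) else 0) =
      (\<Sum>c\<in>T - S. if ?P c then u c else 0)"
    by (rule sum.reindex_bij_betw[OF bij_nodes])
  also have "\<dots> = (\<Sum>c\<in>{c \<in> T - S. ?P c}. u c)"
    using finite_T by (intro sum.inter_filter[symmetric]) simp
  also have "?r * u [] = (\<Sum>c\<in>{\<tau> \<in> S. ?P \<tau>}. u c)"
    using u by simp
  also have "(\<Sum>c\<in>{c \<in> T - S. ?P c}. u c) + (\<Sum>c\<in>{\<tau> \<in> S. ?P \<tau>}. u c) =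
      (\<Sum>c\<in>{c \<in> T - S. ?P c} \<union> {\<tau> \<in> S. ?P \<tau>}. u c)"
    using finite_T finite_S by (intro sum.union_disjoint[symmetric]) auto
  also have "{c \<in> T - S. ?P c} \<union> {\<tau> \<in> S. ?P \<tau>} = children T (nodes ! i)"
    using S_subset_T by (auto simp: children_def)
  finally show ?thesis .
qed

section \<open>The positive eigenvalues\<close>

text \<open>An eigenvector extends to all nodes by its root value at the terminal nodes; it is then
  harmonic, hence a multiple of the leaf weight, and comparison at the root gives the equation.
  Conversely, the equation says that the leaf weight has the same value 1 at the root as at the
  terminal nodes, so that it comes from a vector on the vertices.\<close>

lemma eigenvalue_iff_leaf_weight:
  assumes \<rho>: "0 < \<rho>"
  shows "eigenvalue A \<rho> \<longleftrightarrow> leaf_weight S (1 / \<rho>) [] = 1"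
proof
  let ?n = "length nodes"
  let ?x = "1 / \<rho>"
  assume "eigenvalue A \<rho>"
  then obtain v where v: "v \<in> carrier_vec ?n" "v \<noteq> 0\<^sub>v ?n" "A *\<^sub>v v = \<rho> \<cdot>\<^sub>v v"
    using A_carrier by (auto simp: eigenvalue_def eigenvector_def)
  define u where
    "u \<sigma> = (if \<sigma> \<in> S then v $ 0 else v $ the_inv_into {..<?n} ((!) nodes) \<sigma>)" for \<sigma>
  have u_nodes: "u (nodes ! j) = v $ j" if "j < ?n" for j
  proof -
    have "nodes ! j \<notin> S"
      using nth_mem[OF that] set_nodes by auto
    moreover have "the_inv_into {..<?n} ((!) nodes) (nodes ! j) = j"
      using bij_nodes that by (intro the_inv_into_f_f) (auto simp: bij_betw_def)
    ultimately show ?thesis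
      by (simp add: u_def)
  qed
  have u_Nil: "u [] = v $ 0"
    using u_nodes[OF length_nodes_pos] nodes_0 by simp
  have u_leaf: "u \<tau> = u []" if "\<tau> \<in> S" for \<tau>
    using that u_Nil by (simp add: u_def)
  have v_eq: "v = vec ?n (\<lambda>j. u (nodes ! j))"
    using v(1) u_nodes by (intro eq_vecI) auto
  have "u \<sigma> = ?x * (\<Sum>c\<in>children T \<sigma>. u c)" if "\<sigma> \<in> T - S" for \<sigma>
  proof -
    have "\<sigma> \<in> set nodes"
      using that by (simp only: set_nodes)
    then obtain i where i: "i < ?n" "\<sigma> = nodes ! i"
      by (auto simp: in_set_conv_nth)
    have "(\<Sum>c\<in>children T \<sigma>. u c) = (A *\<^sub>v v) $ i"
      using adjacency_mult_vec[where u = u, OF i(1) u_leaf] i(2) v_eq by simp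
    also have "\<dots> = \<rho> * u \<sigma>"
      using v(1,3) i u_nodes by simp
    finally show ?thesis
      using \<rho> by simp
  qed
  then have u_eq: "u \<sigma> = u [] * leaf_weight S ?x \<sigma>" if "\<sigma> \<in> T" for \<sigma>
    using harmonic_eq_leaf_weight u_leaf that by blast
  have "u [] \<noteq> 0"
  proof
    assume "u [] = 0"
    then have "v $ j = 0" if "j < ?n" for j
      using u_eq[of "nodes ! j"] u_nodes[OF that] nth_mem[OF that] set_nodes by auto
    then have "v = 0\<^sub>v ?n"
      using v(1) by (intro eq_vecI) auto
    with v(2) show False ..
  qed
  then show "leaf_weight S ?x [] = 1"
    using u_eq[of "[]"] Nil_nonterminal by simp
next
  let ?n = "length nodes"
  let ?u = "leaf_weight S (1 / \<rho>)"
  assume root: "?u [] = 1"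
  define v where "v = vec ?n (\<lambda>j. ?u (nodes ! j))"
  have "A *\<^sub>v v = \<rho> \<cdot>\<^sub>v v"
  proof (rule eq_vecI)
    show "dim_vec (A *\<^sub>v v) = dim_vec (\<rho> \<cdot>\<^sub>v v)"
      using A_carrier by (simp add: v_def)
    fix i assume "i < dim_vec (\<rho> \<cdot>\<^sub>v v)"
    then have i: "i < ?n"
      by (simp add: v_def)
    then have "nodes ! i \<notin> S"
      using nth_mem[OF i] set_nodes by auto
    then have "\<rho> * ?u (nodes ! i) = (\<Sum>c\<in>children T (nodes ! i). ?u c)"
      using leaf_weight_nonterminal[of "nodes ! i" "1 / \<rho>"] \<rho> by simp
    also have "\<dots> = (A *\<^sub>v v) $ i"
      unfolding v_def using i root by (simp add: adjacency_mult_vec leaf_weight_terminal)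
    finally show "(A *\<^sub>v v) $ i = (\<rho> \<cdot>\<^sub>v v) $ i"
      using i by (simp add: v_def)
  qed
  moreover have "v $ 0 = 1"
    using length_nodes_pos nodes_0 root by (simp add: v_def)
  then have "v \<noteq> 0\<^sub>v ?n"
    using length_nodes_pos by auto
  moreover have "v \<in> carrier_vec ?n"
    by (simp add: v_def)
  ultimately show "eigenvalue A \<rho>"
    using A_carrier by (auto simp: eigenvalue_def eigenvector_def)
qed

lemma leaf_weight_root_eq_powr_sum:
  assumes "0 < \<rho>"
  shows "leaf_weight S (1 / \<rho>) [] = (\<Sum>\<tau>\<in>S. 2 powr (- log 2 \<rho> * real (length \<tau>)))"
proof -
  have "2 powr (- log 2 \<rho> * real l) = (1 / \<rho>) ^ l" for l
  proof -
    have "2 powr (- log 2 \<rho> * real l) = (2 powr (- log 2 \<rho>)) powr real l"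
      by (simp add: powr_powr)
    also have "2 powr (- log 2 \<rho>) = 1 / \<rho>"
      using assms by (simp add: powr_minus divide_inverse)
    finally show ?thesis
      using assms by (simp add: powr_realpow)
  qed
  then show ?thesis
    by (simp add: leaf_weight_def)
qed

end

theorem theorem5p3:
  fixes m k :: nat and T S :: "nat list set" and \<tau> :: "nat \<Rightarrow> nat list" and \<rho> :: real
  assumes "k \<ge> 2"
    and "finite_tree m T S"
    and "bij_betw \<tau> {..<k} S"
    and "\<rho> = perron_eigenvalue (adjacency_matrix (tree_graph T S))"
  shows "is_channel_capacity k (\<lambda>i. length (\<tau> i)) (log 2 \<rho>)"
proof -
  have card: "2 \<le> card S"
    using assms(1) bij_betw_same_card[OF assms(3)] by simp
  \<comment> \<open>The empty string is a prefix of every other one, so a prefix-free set that contains it has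
      just one element.\<close>
  have "[] \<notin> S"
  proof
    assume "[] \<in> S"
    then have "\<not> strict_prefix [] \<sigma>" if "\<sigma> \<in> S" for \<sigma>
      using assms(2) that by (simp only: finite_tree_def) blast
    then have "S \<subseteq> {[]}"
      by (auto simp: strict_prefix_def)
    then have "card S \<le> 1"
      using card_mono[of "{[]}" S] by simp
    with card show False
      by simp
  qed
  then interpret nontrivial_tree m T S
    using assms(2) card by unfold_locales auto
  have reindex: "(\<Sum>i<k. 2 powr (- \<beta> * real (length (\<tau> i)))) =
      (\<Sum>\<sigma>\<in>S. 2 powr (- \<beta> * real (length \<sigma>)))" for \<beta>
    by (rule sum.reindex_bij_betw[OF assms(3)])
  have "0 < length \<sigma>" if "\<sigma> \<in> S" for \<sigma>
    using that Nil_notin_S by (cases \<sigma>) auto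
  then obtain \<alpha> where \<alpha>: "0 < \<alpha>"
    "\<And>\<beta>. (\<Sum>\<sigma>\<in>S. 2 powr (- \<beta> * real (length \<sigma>))) = 1 \<longleftrightarrow> \<beta> = \<alpha>"
    using ex1_capacity[OF finite_S card] by blast
  have "{r. 0 < r \<and> eigenvalue A r} = {2 powr \<alpha>}"
  proof (intro equalityI subsetI)
    fix r assume "r \<in> {r. 0 < r \<and> eigenvalue A r}"
    then show "r \<in> {2 powr \<alpha>}"
      using \<alpha>(2)[of "log 2 r"]
      by (auto simp: eigenvalue_iff_leaf_weight leaf_weight_root_eq_powr_sum)
  next
    fix r :: real assume "r \<in> {2 powr \<alpha>}"
    then show "r \<in> {r. 0 < r \<and> eigenvalue A r}"
      using \<alpha>(2)[of \<alpha>] by (simp add: eigenvalue_iff_leaf_weight leaf_weight_root_eq_powr_sum)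
  qed
  then have "log 2 \<rho> = \<alpha>"
    using assms(4) by (simp add: perron_eigenvalue_def)
  then show ?thesis
    using \<alpha> by (simp only: is_channel_capacity_def reindex) auto
qed

end
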